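(* The function $\epsilon_{\mathbb{N}}:\mathcal{G}\mathbb{N}\to\mathbb{N}$ given by $\epsilon_{\mathbb{N}}\big(\sum_{i\in\mathbb{N}}p_i\delta_i\big)=\min\{i\mid p_i>0\}$ is a non-free $\mathcal{G}$-algebra.
   Context: $\mathbb{N}=\{0,1,2,\dots\}$ with the powerset $\sigma$-algebra. $(\mathcal{G},\mu,\eta)$ is the Giry monad: for a measurable space $X$, $\mathcal{G}X$ is the set of probability measures on $X$ with the smallest $\sigma$-algebra making all evaluations $ev_U:P\mapsto P(U)$ ($U$ measurable) measurable; $\mathcal{G}f$ is push-forward; $\eta_X(x)=\delta_x$; $\mu_X(Q)(U)=\int_{P\in\mathcal{G}X}P(U)\,dQ$. Every element of $\mathcal{G}\mathbb{N}$ is uniquely $\sum_i p_i\delta_i$ with $p_i\in[0,1]$, $\sum_i p_i=1$. A $\mathcal{G}$-algebra is a measurable map $h:\mathcal{G}X\to X$ with $h\circ\eta_X=1_X$ and $h\circ\mathcal{G}h=h\circ\mu_X$; the free algebras are the algebras $\mu_X:\mathcal{G}^2X\to\mathcal{G}X$ (up to isomorphism of algebras). *)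

theory Defs
  imports "HOL-Probability.Probability"
begin

text \<open>
  The Giry monad on probability measures. \<^term>\<open>prob_algebra X\<close> is the space of
  probability measures on \<^term>\<open>X\<close>, the functor acts by \<^term>\<open>distr\<close> and the unit is
  \<^term>\<open>return X\<close>. The library multiplication \<^const>\<open>join\<close> is for sub-probability measures: it reads
  off the base space from a measure whose \<open>\<sigma>\<close>-algebra is that of \<^term>\<open>subprob_algebra X\<close>, so it
  cannot be applied to a measure on \<^term>\<open>prob_algebra X\<close>.
\<close>

definition giry_mult :: "'a measure \<Rightarrow> 'a measure measure \<Rightarrow> 'a measure" where
  "giry_mult X Q = measure_of (space X) (sets X) (\<lambda>U. \<integral>\<^sup>+ P. emeasure P U \<partial>Q)"

lemma space_giry_mult [simp]: "space (giry_mult X Q) = space X"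
  by (simp add: giry_mult_def)

lemma sets_giry_mult [simp]: "sets (giry_mult X Q) = sets X"
  by (simp add: giry_mult_def)

text \<open>\<^const>\<open>measure_of\<close> yields the zero measure unless the given set function is a measure; here it
  is one.\<close>

lemma giry_mult_eq_bind:
  assumes Q: "Q \<in> space (prob_algebra (prob_algebra X))"
  shows "giry_mult X Q = bind Q (\<lambda>P. P)"
proof -
  have sQ: "sets Q = sets (prob_algebra X)" and pQ: "prob_space Q"
    using Q by (auto simp: space_prob_algebra)
  have ne: "space Q \<noteq> {}" using pQ by (rule prob_space.not_empty)
  have m: "(\<lambda>P. P) \<in> measurable Q (subprob_algebra X)"
    by (rule measurable_prob_algebraD) (simp add: measurable_cong_sets[OF sQ refl])
  have sets_b: "sets (bind Q (\<lambda>P. P)) = sets X"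
    by (rule sets_bind[OF _ ne]) (use m in \<open>auto simp: space_subprob_algebra dest: measurable_space\<close>)
  have "giry_mult X Q
      = measure_of (space X) (sets X) (emeasure (bind Q (\<lambda>P. P)))"
    unfolding giry_mult_def
    by (rule measure_of_eq)
      (auto simp: sets.space_closed sets.sigma_sets_eq emeasure_bind[OF ne m])
  also have "\<dots> = bind Q (\<lambda>P. P)"
    using measure_of_of_measure[of "bind Q (\<lambda>P. P)"]
    by (simp add: sets_b sets_eq_imp_space_eq[OF sets_b])
  finally show ?thesis .
qed

lemma emeasure_giry_mult:
  assumes Q: "Q \<in> space (prob_algebra (prob_algebra X))" and U: "U \<in> sets X"
  shows "emeasure (giry_mult X Q) U = (\<integral>\<^sup>+ P. emeasure P U \<partial>Q)"
proof -
  have sQ: "sets Q = sets (prob_algebra X)" and pQ: "prob_space Q"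
    using Q by (auto simp: space_prob_algebra)
  have ne: "space Q \<noteq> {}" using pQ by (rule prob_space.not_empty)
  have m: "(\<lambda>P. P) \<in> measurable Q (subprob_algebra X)"
    by (rule measurable_prob_algebraD) (simp add: measurable_cong_sets[OF sQ refl])
  show ?thesis
    by (simp add: giry_mult_eq_bind[OF Q] emeasure_bind[OF ne m U])
qed

definition giry_algebra :: "'a measure \<Rightarrow> ('a measure \<Rightarrow> 'a) \<Rightarrow> bool" where
  "giry_algebra X h \<longleftrightarrow>
     h \<in> measurable (prob_algebra X) X \<and>
     (\<forall>x\<in>space X. h (return X x) = x) \<and>
     (\<forall>Q\<in>space (prob_algebra (prob_algebra X)). h (distr Q X h) = h (giry_mult X Q))"

definition giry_algebra_hom ::
    "'a measure \<Rightarrow> ('a measure \<Rightarrow> 'a) \<Rightarrow> 'b measure \<Rightarrow> ('b measure \<Rightarrow> 'b) \<Rightarrow> ('a \<Rightarrow> 'b) \<Rightarrow> bool" where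
  "giry_algebra_hom X h Y k f \<longleftrightarrow>
     f \<in> measurable X Y \<and> (\<forall>P\<in>space (prob_algebra X). f (h P) = k (distr P Y f))"

definition giry_algebra_isomorphic ::
    "'a measure \<Rightarrow> ('a measure \<Rightarrow> 'a) \<Rightarrow> 'b measure \<Rightarrow> ('b measure \<Rightarrow> 'b) \<Rightarrow> bool" where
  "giry_algebra_isomorphic X h Y k \<longleftrightarrow>
     (\<exists>f g. giry_algebra_hom X h Y k f \<and> giry_algebra_hom Y k X h g \<and>
        (\<forall>x\<in>space X. g (f x) = x) \<and> (\<forall>y\<in>space Y. f (g y) = y))"

text \<open>A measure \<open>P\<close> on the naturals is \<open>\<Sum>i. p i * \<delta> i\<close> with \<open>p i = P {i}\<close>.\<close>

definition eps_nat :: "nat measure \<Rightarrow> nat" where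
  "eps_nat P = (LEAST i. measure P {i} > 0)"

lemma eps_nat_eq_Least:
  assumes p: "\<And>i. 0 \<le> p i"
    and P: "sets P = UNIV"
           "\<And>U. emeasure P U = (\<Sum>i. ennreal (p i) * emeasure (return (count_space UNIV) i) U)"
  shows "eps_nat P = (LEAST i. p i > 0)"
proof -
  have "measure P {j} = p j" for j
  proof -
    have "emeasure P {j} = (\<Sum>i. if i = j then ennreal (p i) else 0)"
      unfolding P(2) by (intro suminf_cong) (auto simp: indicator_def)
    also have "\<dots> = ennreal (p j)"
      using sums_unique[OF sums_single[of j "\<lambda>i. ennreal (p i)"]] by simp
    finally show ?thesis using p by (simp add: measure_def)
  qed
  then show ?thesis by (simp add: eps_nat_def)
qed

end

theory Submission
  imports Defs
begin

text \<open>
  \<^emph>\<open>Algebra laws.\<close> Everything rests on a reformulation of the minimum of the support that avoids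
  minima: \<open>n \<le> eps_nat P\<close> holds exactly when \<open>P\<close> gives no mass to \<open>{..<n}\<close>
  (\<open>le_eps_nat_iff\<close>). Both sides of the associativity law can then be compared through their lower
  bounds. For \<open>Q\<close> a measure on measures, \<open>n\<close> is a lower bound of \<open>eps_nat (distr Q _ eps_nat)\<close> iff
  \<open>Q\<close>-almost every \<open>P\<close> satisfies \<open>P {..<n} = 0\<close>, and of \<open>eps_nat (giry_mult _ Q)\<close> iff the integral
  of \<open>P {..<n}\<close> over \<open>Q\<close> vanishes. A nonnegative function has integral zero iff it is zero almost
  everywhere.

  \<^emph>\<open>Non-freeness.\<close> In \<open>eps_nat\<close> the midpoint of \<open>0\<close> and \<open>1\<close> is \<open>0\<close>. A free algebra is a
  convex set of measures, in which the midpoint of \<open>P\<close> and \<open>Q\<close> is \<open>(P + Q) / 2\<close>, and this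
  equals \<open>P\<close> only if \<open>P = Q\<close>. So every homomorphism from \<open>eps_nat\<close> to a free algebra sends \<open>0\<close> and
  \<open>1\<close> to the same measure (\<open>giry_algebra_hom_free_midpoint\<close>) and is not injective.
\<close>

lemma le_eps_nat_iff:
  assumes P: "P \<in> space (prob_algebra (count_space UNIV))"
  shows "n \<le> eps_nat P \<longleftrightarrow> emeasure P {..<n} = 0"
proof -
  interpret prob_space P using P by (simp add: space_prob_algebra)
  have sets_P [simp]: "sets P = UNIV"
    using P by (simp add: space_prob_algebra)
  have space_P: "space P = UNIV"
    using P sets_eq_imp_space_eq[of P "count_space UNIV"] by (simp add: space_prob_algebra)
  \<comment> \<open>Without an atom, \<open>LEAST\<close> would denote an unspecified number.\<close>
  have "\<exists>i. measure P {i} > 0"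
  proof (rule ccontr)
    assume "\<nexists>i. measure P {i} > 0"
    then have "emeasure P {i} = 0" for i
      by (simp add: emeasure_eq_measure zero_less_measure_iff)
    then have "emeasure P UNIV = 0"
      using emeasure_UN_eq_0[of P "\<lambda>i. {i}"] by simp
    then show False
      using emeasure_space_1 space_P by simp
  qed
  then have pos: "measure P {eps_nat P} > 0"
    unfolding eps_nat_def by (rule LeastI_ex)
  show ?thesis
  proof
    assume "n \<le> eps_nat P"
    then have "measure P {i} = 0" if "i < n" for i
      using not_less_Least[of i "\<lambda>i. measure P {i} > 0"] that measure_nonneg[of P "{i}"]
      unfolding eps_nat_def by linarith
    then have "(\<Sum>i<n. emeasure P {i}) = 0"
      by (simp add: emeasure_eq_measure)
    then show "emeasure P {..<n} = 0"
      by (subst emeasure_eq_sum_singleton) auto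
  next
    assume 0: "emeasure P {..<n} = 0"
    show "n \<le> eps_nat P"
    proof (rule ccontr)
      assume "\<not> n \<le> eps_nat P"
      then have "emeasure P {eps_nat P} \<le> emeasure P {..<n}"
        by (intro emeasure_mono) auto
      then show False using 0 pos by (simp add: emeasure_eq_measure)
    qed
  qed
qed

lemma measurable_emeasure_prob_algebra:
  assumes "U \<in> sets X"
  shows "(\<lambda>P. emeasure P U) \<in> borel_measurable (prob_algebra X)"
  unfolding prob_algebra_def
  by (intro measurable_restrict_space1 measurable_emeasure_subprob_algebra assms)

lemma measurable_eps_nat:
  "eps_nat \<in> measurable (prob_algebra (count_space UNIV)) (count_space UNIV)"
proof -
  have [measurable]: "(\<lambda>P. measure P {i}) \<in> borel_measurable (prob_algebra (count_space UNIV))"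
    for i :: nat
    by (rule measurable_measure_prob_algebra) simp
  show ?thesis unfolding eps_nat_def[abs_def] by measurable
qed

lemma eps_nat_return: "eps_nat (return (count_space UNIV) n) = n"
  unfolding eps_nat_def
  by (rule Least_equality) (auto simp: measure_return indicator_def split: if_splits)

lemma giry_mult_in_prob_algebra:
  assumes Q: "Q \<in> space (prob_algebra (prob_algebra X))"
  shows "giry_mult X Q \<in> space (prob_algebra X)"
  unfolding giry_mult_eq_bind[OF Q]
  by (rule measurable_space[OF measurable_bind_prob_space[where M = "prob_algebra (prob_algebra X)",
        OF measurable_ident_sets[OF refl]]])
    (use Q in auto)

text \<open>Two naturals with the same lower bounds are equal, and the lower bounds of either side
  describe the same null sets of measures.\<close>

lemma eps_nat_mult:
  assumes Q: "Q \<in> space (prob_algebra (prob_algebra (count_space UNIV)))"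
  shows "eps_nat (distr Q (count_space UNIV) eps_nat) = eps_nat (giry_mult (count_space UNIV) Q)"
proof -
  let ?N = "count_space UNIV :: nat measure"
  have sets_Q [measurable_cong]: "sets Q = sets (prob_algebra ?N)" and "prob_space Q"
    using Q by (auto simp: space_prob_algebra)
  interpret prob_space Q by fact
  note space_Q = sets_eq_imp_space_eq[OF sets_Q]
  have eps [measurable]: "eps_nat \<in> measurable Q ?N"
    using measurable_eps_nat by (simp add: measurable_cong_sets[OF sets_Q refl])
  have distr: "distr Q ?N eps_nat \<in> space (prob_algebra ?N)"
    by (simp add: space_prob_algebra prob_space_distr)
  have ev [measurable]: "(\<lambda>P. emeasure P {..<n}) \<in> borel_measurable Q" for n :: nat
    unfolding measurable_cong_sets[OF sets_Q refl]
    by (rule measurable_emeasure_prob_algebra) simp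
  have "n \<le> eps_nat (distr Q ?N eps_nat) \<longleftrightarrow> n \<le> eps_nat (giry_mult ?N Q)" for n
  proof -
    have "n \<le> eps_nat (distr Q ?N eps_nat) \<longleftrightarrow> emeasure (distr Q ?N eps_nat) {..<n} = 0"
      by (rule le_eps_nat_iff[OF distr])
    also have "\<dots> \<longleftrightarrow> emeasure Q {P \<in> space Q. \<not> n \<le> eps_nat P} = 0"
      by (simp add: emeasure_distr vimage_def Int_def conj_commute not_le)
    also have "\<dots> \<longleftrightarrow> (AE P in Q. n \<le> eps_nat P)"
      by (rule AE_iff_measurable[symmetric]) (auto intro: measurable_sets_Collect)
    also have "\<dots> \<longleftrightarrow> (AE P in Q. emeasure P {..<n} = 0)"
      by (rule AE_cong) (simp add: space_Q le_eps_nat_iff)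
    also have "\<dots> \<longleftrightarrow> emeasure (giry_mult ?N Q) {..<n} = 0"
      by (simp add: emeasure_giry_mult[OF Q] nn_integral_0_iff_AE)
    also have "\<dots> \<longleftrightarrow> n \<le> eps_nat (giry_mult ?N Q)"
      by (rule le_eps_nat_iff[OF giry_mult_in_prob_algebra[OF Q], symmetric])
    finally show ?thesis .
  qed
  then show ?thesis by (meson order_antisym order_refl)
qed

lemma giry_algebra_eps_nat: "giry_algebra (count_space UNIV) eps_nat"
  by (simp add: giry_algebra_def measurable_eps_nat eps_nat_return eps_nat_mult)

text \<open>The free algebra averages measures, so the hypothesis on \<open>h\<close> gives \<open>(f x + f y) / 2 = f x\<close> on
  every measurable set; the values are finite, so \<open>f y\<close> can be isolated.\<close>

lemma giry_algebra_hom_free_midpoint: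
  assumes hom: "giry_algebra_hom (count_space UNIV) h (prob_algebra X) (giry_mult X) f"
    and mid: "h (measure_pmf (pmf_of_set {x, y})) = x"
  shows "f x = f y"
proof (cases "x = y")
  case False
  let ?C = "count_space UNIV" and ?M = "measure_pmf (pmf_of_set {x, y})"
  let ?Q = "distr ?M (prob_algebra X) f"
  have f: "f \<in> measurable ?C (prob_algebra X)"
    and f_h: "\<And>P. P \<in> space (prob_algebra ?C) \<Longrightarrow> f (h P) = giry_mult X (distr P (prob_algebra X) f)"
    using hom by (auto simp: giry_algebra_hom_def)
  have M: "?M \<in> space (prob_algebra ?C)"
    by (simp add: space_prob_algebra prob_space_measure_pmf)
  have fM: "f \<in> measurable ?M (prob_algebra X)"
    using f by simp
  have Q: "?Q \<in> space (prob_algebra (prob_algebra X))"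
    by (simp add: space_prob_algebra measure_pmf.prob_space_distr[OF fM])
  have f_prob: "f z \<in> space (prob_algebra X)" for z
    using measurable_space[OF f] by simp
  show ?thesis
  proof (rule measure_eqI)
    show "sets (f x) = sets (f y)"
      using f_prob by (simp add: space_prob_algebra)
  next
    fix U assume "U \<in> sets (f x)"
    then have U: "U \<in> sets X"
      using f_prob[of x] by (simp add: space_prob_algebra)
    interpret fx: prob_space "f x" using f_prob[of x] by (simp add: space_prob_algebra)
    interpret fy: prob_space "f y" using f_prob[of y] by (simp add: space_prob_algebra)
    have "emeasure (f x) U = (\<integral>\<^sup>+ P. emeasure P U \<partial>?Q)"
      using f_h[OF M] by (simp add: mid emeasure_giry_mult[OF Q U])
    also have "\<dots> = (\<integral>\<^sup>+ z. emeasure (f z) U \<partial>?M)"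
      by (rule nn_integral_distr[OF fM]) (simp add: measurable_emeasure_prob_algebra U)
    also have "\<dots> = (emeasure (f x) U + emeasure (f y) U) / 2"
      using False by (simp add: nn_integral_pmf_of_set)
    finally have "ennreal (measure (f x) U) = ennreal ((measure (f x) U + measure (f y) U) / 2)"
      by (simp add: fx.emeasure_eq_measure fy.emeasure_eq_measure divide_ennreal[symmetric]
          ennreal_numeral)
    then have "measure (f x) U = (measure (f x) U + measure (f y) U) / 2"
      by (subst (asm) ennreal_inj) auto
    then show "emeasure (f x) U = emeasure (f y) U"
      by (simp add: fx.emeasure_eq_measure fy.emeasure_eq_measure)
  qed
qed simp

lemma eps_nat_midpoint_0_1: "eps_nat (measure_pmf (pmf_of_set {0, 1})) = 0"
  unfolding eps_nat_def by (rule Least_equality) (auto simp: measure_pmf_single)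

theorem lemma2p2:
  shows "giry_algebra (count_space UNIV :: nat measure) eps_nat \<and>
    \<not> (\<exists>X :: 'b measure.
        giry_algebra_isomorphic (count_space UNIV :: nat measure) eps_nat
          (prob_algebra X) (giry_mult X))"
proof (intro conjI notI)
  assume "\<exists>X :: 'b measure.
        giry_algebra_isomorphic (count_space UNIV :: nat measure) eps_nat
          (prob_algebra X) (giry_mult X)"
  then obtain X :: "'b measure" and f g
    where hom: "giry_algebra_hom (count_space UNIV) eps_nat (prob_algebra X) (giry_mult X) f"
      and gf: "\<And>n. g (f n) = n"
    by (auto simp: giry_algebra_isomorphic_def)
  have "f 0 = f 1"
    by (rule giry_algebra_hom_free_midpoint[OF hom eps_nat_midpoint_0_1])
  then show False
    using gf[of 0] gf[of 1] by simp
qed (rule giry_algebra_eps_nat)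

end
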